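(* Let $\mathcal{A}$ be a complex Banach $*$-algebra with identity. Let $a\in\mathcal{A}$ be an EP element, let $b\in\mathcal{A}$ be such that both $b$ and $ba^{\pi}$ are core invertible, and suppose $aba^{\pi}=0$. Then the following are equivalent: (1) $a+b$ is core invertible and $a(a+b)^{\mathrm{core}}a^{\pi}=0$. (2) $a(1+a^{\#}b)$ is core invertible and $b^{\pi}a^{\pi}b=0$.
   Context: An involution on a Banach algebra $\mathcal{A}$ is a map $*:\mathcal{A}\to\mathcal{A}$ with $(x+y)^*=x^*+y^*$, $(xy)^*=y^*x^*$, $(x^* )^*=x$ for all $x,y$; a Banach algebra with an involution is called a Banach $*$-algebra. An element $a\in\mathcal{A}$ is group invertible if there is $x\in\mathcal{A}$ with $axa=a$, $xax=x$, $ax=xa$; such $x$ is unique and is denoted $a^{\#}$, and then $a^{\pi}:=1-aa^{\#}$. An element $a$ is core invertible if there is $x\in\mathcal{A}$ with $xa^2=a$, $ax^2=x$, $(ax)^*=ax$; such $x$ is unique and is denoted $a^{\mathrm{core}}$. An element $a$ is EP if there is $x\in\mathcal{A}$ with $xa^2=a$, $ax=xa$, $(ax)^*=ax$. Every core invertible element and every EP element is group invertible, so $a^{\#}$ and $a^{\pi}$ make sense for such $a$. *)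

theory Defs
  imports Complex_Main
begin

text \<open>
  The distribution has only real normed algebras, so complex scalars are added here; the real
  scalar multiplication is the restriction of the complex one. The identity is supplied by
  \<^class>\<open>monoid_mult\<close>, so neither \<open>norm 1 = 1\<close> nor \<open>1 \<noteq> 0\<close> is assumed.
\<close>

class complex_banach_algebra_1 = real_normed_algebra + banach + monoid_mult +
  fixes scaleC :: "complex \<Rightarrow> 'a \<Rightarrow> 'a"
  assumes scaleC_add_right: "scaleC c (x + y) = scaleC c x + scaleC c y"
    and scaleC_add_left: "scaleC (c + d) x = scaleC c x + scaleC d x"
    and scaleC_scaleC: "scaleC c (scaleC d x) = scaleC (c * d) x"
    and scaleC_of_real: "scaleC (complex_of_real r) x = scaleR r x"
    and mult_scaleC_left: "scaleC c x * y = scaleC c (x * y)"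
    and mult_scaleC_right: "x * scaleC c y = scaleC c (x * y)"
    and norm_scaleC: "norm (scaleC c x) = cmod c * norm x"

text \<open>The involution is not required to be conjugate-linear or continuous.\<close>

class complex_banach_star_algebra_1 = complex_banach_algebra_1 +
  fixes star :: "'a \<Rightarrow> 'a"
  assumes star_add: "star (x + y) = star x + star y"
    and star_mult: "star (x * y) = star y * star x"
    and star_star: "star (star x) = x"

definition is_group_inverse :: "'a::{ring,monoid_mult} \<Rightarrow> 'a \<Rightarrow> bool"
  where "is_group_inverse a x \<longleftrightarrow> a * x * a = a \<and> x * a * x = x \<and> a * x = x * a"

definition group_invertible :: "'a::{ring,monoid_mult} \<Rightarrow> bool"
  where "group_invertible a \<longleftrightarrow> (\<exists>x. is_group_inverse a x)"

definition group_inv :: "'a::{ring,monoid_mult} \<Rightarrow> 'a"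
  where "group_inv a = (THE x. is_group_inverse a x)"

text \<open>\<open>spectral_idem a\<close> is the element written \<open>a\<close> with superscript \<open>\<pi>\<close>.\<close>

definition spectral_idem :: "'a::{ring,monoid_mult} \<Rightarrow> 'a"
  where "spectral_idem a = 1 - a * group_inv a"

definition is_core_inverse :: "'a::complex_banach_star_algebra_1 \<Rightarrow> 'a \<Rightarrow> bool"
  where "is_core_inverse a x \<longleftrightarrow> x * a\<^sup>2 = a \<and> a * x\<^sup>2 = x \<and> star (a * x) = a * x"

definition core_invertible :: "'a::complex_banach_star_algebra_1 \<Rightarrow> bool"
  where "core_invertible a \<longleftrightarrow> (\<exists>x. is_core_inverse a x)"

definition core_inv :: "'a::complex_banach_star_algebra_1 \<Rightarrow> 'a"
  where "core_inv a = (THE x. is_core_inverse a x)"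

definition EP :: "'a::complex_banach_star_algebra_1 \<Rightarrow> bool"
  where "EP a \<longleftrightarrow> (\<exists>x. x * a\<^sup>2 = a \<and> a * x = x * a \<and> star (a * x) = a * x)"


text \<open>
  Uniqueness and existence, so that the descriptions above denote the intended elements.
\<close>

lemma is_group_inverse_unique:
  fixes a :: "'a::{ring,monoid_mult}"
  assumes x: "is_group_inverse a x" and y: "is_group_inverse a y"
  shows "x = y"
proof -
  have x1: "a * x * a = a" and x2: "x * a * x = x" and x3: "a * x = x * a"
    and y1: "a * y * a = a" and y2: "y * a * y = y" and y3: "a * y = y * a"
    using x y by (auto simp: is_group_inverse_def)
  have "a * x = (a * y * a) * x" by (simp only: y1)
  also have "\<dots> = (a * y) * (a * x)" by (simp only: mult.assoc)
  also have "\<dots> = (y * a) * (x * a)" by (simp only: x3 y3)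
  also have "\<dots> = y * (a * x * a)" by (simp only: mult.assoc)
  finally have ax: "a * x = a * y" by (simp only: x1 y3)
  have "x = x * (a * x)" using x2 by (simp only: mult.assoc)
  also have "\<dots> = (x * a) * y" by (simp only: ax mult.assoc)
  also have "\<dots> = (y * a) * y" using ax x3 y3 by simp
  finally show ?thesis by (simp only: y2)
qed

lemma group_inv_eq: "is_group_inverse a x \<Longrightarrow> group_inv a = x"
  unfolding group_inv_def by (blast intro: is_group_inverse_unique)

lemma core_inverse_inner:
  assumes "is_core_inverse a x"
  shows "a * x * a = a"
proof -
  have x1: "x * (a * a) = a" and x2: "a * (x * x) = x"
    using assms by (auto simp: is_core_inverse_def power2_eq_square)
  have "a * x * a = a * x * (x * (a * a))" by (simp only: x1)
  also have "\<dots> = a * (x * x) * (a * a)" by (simp only: mult.assoc)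
  also have "\<dots> = a" by (simp only: x2 x1)
  finally show ?thesis .
qed

lemma is_core_inverse_unique:
  assumes x: "is_core_inverse a x" and y: "is_core_inverse a y"
  shows "x = y"
proof -
  have x1: "x * (a * a) = a" and x2: "a * (x * x) = x" and x3: "star (a * x) = a * x"
    and y1: "y * (a * a) = a" and y2: "a * (y * y) = y" and y3: "star (a * y) = a * y"
    using x y by (auto simp: is_core_inverse_def power2_eq_square)
  have xy: "(a * x) * (a * y) = a * y" and yx: "(a * y) * (a * x) = a * x"
    using core_inverse_inner[OF x] core_inverse_inner[OF y] by (simp_all flip: mult.assoc)
  have "a * x = star (a * x)" by (simp only: x3)
  also have "\<dots> = star ((a * y) * (a * x))" by (simp only: yx)
  also have "\<dots> = star (a * x) * star (a * y)" by (rule star_mult)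
  also have "\<dots> = a * y" by (simp only: x3 y3 xy)
  finally have ax: "a * x = a * y" .
  have "x = a * (x * x)" by (simp only: x2)
  also have "\<dots> = x * (a * a) * (x * x)" by (simp only: x1)
  also have "\<dots> = x * (a * (a * (x * x)))" by (simp only: mult.assoc)
  also have "\<dots> = x * (a * (a * (y * y)))" by (simp only: x2 y2 ax)
  also have "\<dots> = x * (a * a) * (y * y)" by (simp only: mult.assoc)
  also have "\<dots> = y" by (simp only: x1 y2)
  finally show ?thesis .
qed

lemma core_inv_eq: "is_core_inverse a x \<Longrightarrow> core_inv a = x"
  unfolding core_inv_def by (blast intro: is_core_inverse_unique)

lemma group_invertible_if_core_invertible:
  assumes "core_invertible a"
  shows "group_invertible a"
proof -
  obtain x where x1: "x * (a * a) = a" and x2: "a * (x * x) = x"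
    using assms by (auto simp: core_invertible_def is_core_inverse_def power2_eq_square)
  have "a * (x * x * a) = a * (x * x) * a" by (simp only: mult.assoc)
  then have l: "a * (x * x * a) = x * a" by (simp only: x2)
  have "x * x * a * a = x * (x * (a * a))" by (simp only: mult.assoc)
  then have r: "x * x * a * a = x * a" by (simp only: x1)
  have "x * a * (x * x * a) = x * (a * (x * x * a))" by (simp only: mult.assoc)
  also have "\<dots> = x * (x * a)" by (simp only: l)
  finally have m: "x * a * (x * x * a) = x * x * a" by (simp only: mult.assoc)
  have "x * a * a = a" using x1 by (simp only: mult.assoc)
  then have "is_group_inverse a (x * x * a)"
    unfolding is_group_inverse_def by (simp only: l r m)
  then show ?thesis by (auto simp: group_invertible_def)
qed

lemma group_invertible_if_EP:
  assumes "EP a"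
  shows "group_invertible a"
proof -
  obtain x where x1: "x * (a * a) = a" and x2: "a * x = x * a"
    using assms by (auto simp: EP_def power2_eq_square)
  have "a * (x * x * a) = (a * x) * (x * a)" by (simp only: mult.assoc)
  also have "\<dots> = (x * a) * (x * a)" by (simp only: x2)
  also have "\<dots> = x * (a * x) * a" by (simp only: mult.assoc)
  also have "\<dots> = x * (x * a) * a" by (simp only: x2)
  also have "\<dots> = x * (x * (a * a))" by (simp only: mult.assoc)
  finally have l: "a * (x * x * a) = x * a" by (simp only: x1)
  have "x * x * a * a = x * (x * (a * a))" by (simp only: mult.assoc)
  then have r: "x * x * a * a = x * a" by (simp only: x1)
  have "x * a * (x * x * a) = x * (a * (x * x * a))" by (simp only: mult.assoc)
  also have "\<dots> = x * (x * a)" by (simp only: l)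
  finally have m: "x * a * (x * x * a) = x * x * a" by (simp only: mult.assoc)
  have "x * a * a = a" using x1 by (simp only: mult.assoc)
  then have "is_group_inverse a (x * x * a)"
    unfolding is_group_inverse_def by (simp only: l r m)
  then show ?thesis by (auto simp: group_invertible_def)
qed

end

theory Submission
  imports Defs
begin

text \<open>
  Let \<open>p = a * group_inv a\<close>, a self-adjoint idempotent since \<open>a\<close> is EP, and \<open>q = 1 - p\<close>. The
  hypothesis \<open>a * b * q = 0\<close> makes \<open>a + b\<close> block lower triangular for the Peirce decomposition
  given by \<open>p\<close>, with diagonal blocks \<open>s = a * (1 + group_inv a * b)\<close> and \<open>c = b * q\<close> and
  off-diagonal block \<open>d = q * b * p\<close>. A core inverse \<open>x\<close> of \<open>a + b\<close> with \<open>p * x * q = 0\<close> is lower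
  triangular too, so the self-adjoint element \<open>(a + b) * x\<close> is diagonal; comparing blocks, such an
  \<open>x\<close> exists iff \<open>s\<close> is core invertible and the range of \<open>d\<close> lies in that of \<open>c\<close>. As
  \<open>group_inv b * q = group_inv c\<close>, the latter is the condition on the spectral idempotents.
\<close>

text \<open>Lets a rewrite rule for \<open>u * v\<close> also fire inside products that the
  simplifier has nested to the right.\<close>

lemma mult_eq_assoc: "u * v = w \<Longrightarrow> u * (v * z) = w * z" for u :: "'a::semigroup_mult"
  by (metis mult.assoc)

lemma star_one [simp]: "star 1 = (1 :: 'a::complex_banach_star_algebra_1)"
  by (metis mult_1_left star_mult star_star)

lemma star_diff: "star (x - y) = star x - star (y :: 'a::complex_banach_star_algebra_1)"
  by (metis add_diff_cancel diff_add_cancel star_add)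

lemma core_inverse_outer:
  assumes "is_core_inverse a x"
  shows "x * a * x = x"
  using assms unfolding is_core_inverse_def power2_eq_square by (metis mult.assoc)

text \<open>\<open>x = s * (x * x)\<close> absorbs \<open>p\<close> on the left as \<open>s\<close>
  does. The adjoint of \<open>p * (s * x) = s * x\<close> moves \<open>p\<close> to the right, and
  \<open>x = x * (s * x)\<close> inherits it.\<close>

lemma core_inverse_corner:
  assumes x: "is_core_inverse s x" and p: "star p = p" and ps: "p * s = s"
  shows "p * x = x" "x * p = x"
proof -
  have x2: "s * (x * x) = x" and x3: "star (s * x) = s * x"
    using x by (auto simp: is_core_inverse_def power2_eq_square)
  show "p * x = x" by (metis x2 ps mult.assoc)
  have "s * x * p = s * x" by (metis x3 p ps star_mult mult.assoc)
  then show "x * p = x" by (metis core_inverse_outer[OF x] mult.assoc)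
qed

lemma group_inverse_if_core_inverse:
  assumes "is_core_inverse a x"
  shows "is_group_inverse a (x * x * a)" "a * (x * x * a) = x * a"
proof -
  have r: "x * (a * a) = a" "a * (x * x) = x"
    using assms by (auto simp: is_core_inverse_def power2_eq_square)
  show l: "a * (x * x * a) = x * a" by (metis r(2) mult.assoc)
  show "is_group_inverse a (x * x * a)"
    unfolding is_group_inverse_def l by (metis r mult.assoc)
qed

lemma EP_group_inverse:
  assumes "EP a"
  shows "is_group_inverse a (group_inv a)" "star (a * group_inv a) = a * group_inv a"
proof -
  obtain x where x: "x * a\<^sup>2 = a" "a * x = x * a" "star (a * x) = a * x"
    using assms by (auto simp: EP_def)
  show g: "is_group_inverse a (group_inv a)"
    using group_invertible_if_EP[OF assms] group_inv_eq by (auto simp: group_invertible_def)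
  \<comment> \<open>With \<open>g = group_inv a\<close>:
    \<open>a * g = x * a * a * g = x * (a * g * a) = x * a\<close>.\<close>
  have "a * group_inv a = x * a"
    using g x(1) unfolding is_group_inverse_def power2_eq_square by (metis mult.assoc)
  then show "star (a * group_inv a) = a * group_inv a" using x by simp
qed

text \<open>The witness is the usual inverse formula for a lower triangular block matrix. Its
  product with \<open>?t\<close> has off-diagonal block \<open>d * x - c * y * d * x\<close>, which
  \<open>cyd\<close> annihilates, so the product is diagonal and self-adjoint.\<close>

lemma triangular_core_inverse:
  fixes p s c d :: "'a::complex_banach_star_algebra_1"
  assumes p: "star p = p"
    and s: "p * s = s" "s * p = s" and c: "p * c = 0" "c * p = 0" and d: "p * d = 0" "d * p = d"
    and x: "is_core_inverse s x" and y: "is_core_inverse c y" and cyd: "c * y * d = d"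
  shows "is_core_inverse (s + d + c) (x - y * d * x + y)" (is "is_core_inverse ?t ?z")
    and "p * (x - y * d * x + y) * (1 - p) = 0"
proof -
  have q: "star (1 - p) = 1 - p" "(1 - p) * c = c"
    using p c by (simp_all add: star_diff algebra_simps)
  have px: "p * x = x" "x * p = x" using core_inverse_corner[OF x p s(1)] by auto
  have "(1 - p) * y = y" "y * (1 - p) = y" using core_inverse_corner[OF y q] by auto
  then have py: "p * y = 0" "y * p = 0" by (simp_all add: algebra_simps)
  have ann: "u * v = 0" if "u * p = u" "p * v = 0" for u v :: 'a
    by (metis that mult.assoc mult_zero_right)
  have ann': "u * v = 0" if "u * p = 0" "p * v = v" for u v :: 'a
    by (metis that mult.assoc mult_zero_left)
  have xr: "x * (s * s) = s" "s * (x * x) = x" "star (s * x) = s * x"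
    and yr: "y * (c * c) = c" "c * (y * y) = y" "star (c * y) = c * y"
    using x y by (auto simp: is_core_inverse_def power2_eq_square)
  \<comment> \<open>Put \<open>d = c * y * d\<close> on the left-hand side and use
    \<open>y * (c * c) = c\<close>.\<close>
  have ycd: "y * (c * d) = d" by (metis cyd yr(1) mult.assoc)
  have zeros: "s * d = 0" "s * c = 0" "s * y = 0" "d * d = 0" "d * c = 0" "d * y = 0"
    "x * d = 0" "x * c = 0" "x * y = 0" "c * s = 0" "c * x = 0" "y * s = 0" "y * x = 0"
    using s c d px py by (auto intro: ann ann')
  note rules = zeros zeros[THEN mult_eq_assoc] xr(1,2) yr(1,2)
    cyd[unfolded mult.assoc] ycd
  have cydx: "c * (y * (d * x)) = d * x" by (metis cyd mult.assoc)
  have tz: "?t * ?z = s * x + c * y"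
    by (simp add: algebra_simps rules cydx)
  show "p * ?z * (1 - p) = 0"
    by (simp add: algebra_simps px py px[THEN mult_eq_assoc] py[THEN mult_eq_assoc])
  have "?t * (?z * ?z) = (s * x + c * y) * ?z" by (simp only: tz flip: mult.assoc)
  also have "\<dots> = s * (x * x) + c * (y * y) - c * (y * y) * (d * x)"
    by (simp add: algebra_simps zeros zeros[THEN mult_eq_assoc])
  also have "\<dots> = ?z" by (simp only: xr yr) (simp add: algebra_simps)
  finally have 2: "?t * (?z * ?z) = ?z" .
  have "?z * (?t * ?t) = x * (s * s) - y * d * (x * (s * s)) + y * (d * s) + y * (c * d) + y * (c * c)"
    by (simp add: algebra_simps zeros zeros[THEN mult_eq_assoc])
  also have "\<dots> = ?t" by (simp only: xr yr ycd) (simp add: algebra_simps)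
  finally have "?z * (?t * ?t) = ?t" .
  with 2 tz show "is_core_inverse ?t ?z"
    by (simp add: is_core_inverse_def power2_eq_square star_add xr yr)
qed

text \<open>The condition \<open>pzq\<close> makes \<open>z\<close> lower triangular, hence
  \<open>?t * z\<close> too; being self-adjoint it is diagonal, with upper block
  \<open>s * (p * z)\<close>. The upper blocks of the defining equations of \<open>z\<close> are
  then those of a core inverse of \<open>s\<close>.\<close>

lemma triangular_core_inverseD:
  fixes p s c d :: "'a::complex_banach_star_algebra_1"
  assumes p: "star p = p" "p * p = p"
    and s: "p * s = s" "s * p = s" and c: "p * c = 0" "c * p = 0" and d: "p * d = 0" "d * p = d"
    and z: "is_core_inverse (s + d + c) z" and pzq: "p * z * (1 - p) = 0"
  shows "is_core_inverse s (p * z)" and "\<exists>w. c * w = d"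
proof -
  let ?t = "s + d + c"
  have zr: "z * (?t * ?t) = ?t" "?t * (z * z) = z" "star (?t * z) = ?t * z"
    using z by (auto simp: is_core_inverse_def power2_eq_square)
  have pz: "p * z * p = p * z" using pzq by (simp add: right_diff_distrib)
  have pt: "p * ?t = s" and tp: "?t * p = s + d" using s c d by (simp_all add: algebra_simps)
  have ptz: "p * (?t * z) = s * z" by (metis pt mult.assoc)
  have sz: "s * z * p = s * z" and sz': "s * z = s * (p * z)" by (metis pz s(2) mult.assoc)+
  have "p * (?t * z) * p = p * (?t * z)" using sz ptz by simp
  \<comment> \<open>Taking adjoints: a self-adjoint lower triangular element is diagonal.\<close>
  then have "p * (?t * z) * p = ?t * z * p" by (metis p(1) zr(3) star_mult mult.assoc)
  then have tzp: "?t * z * p = s * z" using sz ptz by simp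
  have "star (s * z) = s * z" by (metis ptz tzp p(1) zr(3) star_mult)
  moreover have "p * z * (s * s) = s"
  proof -
    have "p * z * (s * s) = p * z * (p * ?t * (p * ?t))" by (simp only: pt)
    also have "\<dots> = p * z * (p * ?t * ?t)" using s by (metis pt mult.assoc)
    also have "\<dots> = p * (z * (?t * ?t))" by (metis pz mult.assoc)
    finally show ?thesis by (simp only: zr pt)
  qed
  moreover have "s * (p * z * (p * z)) = p * z"
  proof -
    have "s * (p * z * (p * z)) = s * z * z" by (metis pz s(2) mult.assoc)
    also have "\<dots> = p * (?t * (z * z))" by (metis pt mult.assoc)
    finally show ?thesis by (simp only: zr)
  qed
  ultimately show "is_core_inverse s (p * z)"
    by (simp add: is_core_inverse_def power2_eq_square flip: sz')
  have tzt: "?t * z * ?t = ?t" using core_inverse_inner[OF z] .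
  have szt: "s * z * ?t = s" by (metis tzt ptz pt mult.assoc)
  have "s * z * d = 0" by (metis sz d(1) mult.assoc mult_zero_right)
  moreover have "s * z * (s + d) = s" by (metis szt tp s(2) mult.assoc)
  ultimately have "s * z * s = s" by (simp add: distrib_left)
  moreover have "?t * z * s = s * z * s" by (metis tzp s(1) mult.assoc)
  ultimately have dcz: "(d + c) * z * s = 0" by (simp add: distrib_right add.assoc)
  \<comment> \<open>The lower row of \<open>?t * z * ?t = ?t\<close>. Its first column loses the
    term with \<open>s\<close> by \<open>dcz\<close>, and \<open>d * z * d = 0\<close> since
    \<open>z\<close> is triangular, so \<open>z * d\<close> is the required
    \<open>w\<close>.\<close>
  have "(d + c) * z * ?t = d + c"
    using tzt szt by (metis add.assoc add_left_cancel distrib_right)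
  then have "(d + c) * z * ?t * p = d" using c d by (simp add: algebra_simps)
  then have "(d + c) * z * (s + d) = d" by (metis tp mult.assoc)
  then have "(d + c) * z * d = d" using dcz by (simp add: distrib_left)
  moreover have "d * z * d = 0" by (metis pz d mult.assoc mult_zero_right)
  ultimately have "c * (z * d) = d" by (simp add: distrib_right mult.assoc)
  then show "\<exists>w. c * w = d" by blast
qed

lemma triangular_core_invertible_iff:
  fixes p s c d :: "'a::complex_banach_star_algebra_1"
  assumes p: "star p = p" "p * p = p"
    and s: "p * s = s" "s * p = s" and c: "p * c = 0" "c * p = 0" and d: "p * d = 0" "d * p = d"
    and y: "is_core_inverse c y"
  shows "core_invertible (s + d + c) \<and> p * core_inv (s + d + c) * (1 - p) = 0 \<longleftrightarrow>
    core_invertible s \<and> c * y * d = d" (is "?L \<longleftrightarrow> ?R")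
proof
  assume ?L
  then obtain z where z: "is_core_inverse (s + d + c) z" "p * z * (1 - p) = 0"
    using core_inv_eq unfolding core_invertible_def by metis
  note D = triangular_core_inverseD[OF p s c d z]
  then obtain w where "d = c * w" by metis
  \<comment> \<open>The idempotent \<open>c * y\<close> fixes every multiple
    \<open>c * w\<close>.\<close>
  then have "c * y * d = d" using core_inverse_inner[OF y] by (simp flip: mult.assoc)
  with D(1) show ?R unfolding core_invertible_def by blast
next
  assume ?R
  then obtain x where x: "is_core_inverse s x" and cyd: "c * y * d = d"
    unfolding core_invertible_def by blast
  note I = triangular_core_inverse[OF p(1) s c d x y cyd]
  then show ?L using core_inv_eq[OF I(1)] unfolding core_invertible_def by auto
qed

text \<open>With \<open>c = b * q\<close>, the hypothesis \<open>q\<close> gives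
  \<open>c = c * c * g = b * b * g\<close>. Applying \<open>z\<close> yields
  \<open>z * c = b * g = g * c\<close>, and \<open>z * q = z * z * c\<close> then collapses to
  \<open>g * c * g = g\<close>.\<close>

lemma group_inverse_mult_corner:
  fixes b q :: "'a::{ring,monoid_mult}"
  assumes b: "is_group_inverse b z" and c: "is_group_inverse (b * q) g"
    and q: "q * (b * q) = b * q"
  shows "z * q = g"
proof -
  have cg: "b * q * g * (b * q) = b * q" "g * (b * q) * g = g" "b * q * g = g * (b * q)"
    using c by (auto simp: is_group_inverse_def)
  have bz: "b * z * b = b" "z * b * z = z" "b * z = z * b"
    using b by (auto simp: is_group_inverse_def)
  have qg: "q * g = g" by (metis cg q mult.assoc)
  have bg: "b * q * g = b * g" by (metis qg mult.assoc)
  have "b * q = b * q * (b * q) * g" by (metis cg(1,3) mult.assoc)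
  also have "\<dots> = b * b * g" by (metis q bg mult.assoc)
  finally have "z * (b * q) = b * g" by (metis bz(1,3) mult.assoc)
  then have zc: "z * (b * q) = g * (b * q)" using cg(3) bg by simp
  have "z * q = z * (z * (b * q))" by (metis bz(2,3) mult.assoc)
  also have "\<dots> = z * (b * q) * g" by (metis zc cg(3) mult.assoc)
  also have "\<dots> = g" using zc cg(2) by simp
  finally show ?thesis .
qed

theorem theorem2p4:
  fixes a b :: "'a::complex_banach_star_algebra_1"
  assumes "EP a"
    and "core_invertible b"
    and "core_invertible (b * spectral_idem a)"
    and "a * b * spectral_idem a = 0"
  shows "(core_invertible (a + b) \<and> a * core_inv (a + b) * spectral_idem a = 0) \<longleftrightarrow>
         (core_invertible (a * (1 + group_inv a * b)) \<and> spectral_idem b * spectral_idem a * b = 0)"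
proof -
  define h where "h = group_inv a"
  define p where "p = a * h"
  define q where "q = 1 - p"
  define c where "c = b * q"
  define d where "d = q * b * p"
  define s where "s = a + p * b"
  have q_eq: "spectral_idem a = q" by (simp add: spectral_idem_def q_def p_def h_def)
  have star_p: "star p = p" using EP_group_inverse(2)[OF assms(1)] by (simp add: p_def h_def)
  have ah: "a * h * a = a" "h * a * h = h" "a * h = h * a"
    using EP_group_inverse(1)[OF assms(1)] by (auto simp: is_group_inverse_def h_def)
  have pa: "p * a = a" "a * p = a" by (metis ah p_def mult.assoc)+
  have pp: "p * p = p" by (metis pa(1) p_def mult.assoc)
  have qq: "q * q = q" "p * q = 0" "q * p = 0" by (simp_all add: q_def algebra_simps pp)
  \<comment> \<open>Since \<open>p = h * a\<close> and \<open>a = a * p\<close>, left factors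
    \<open>a\<close> and \<open>p\<close> have the same annihilator.\<close>
  have p_zero_iff: "p * u = 0 \<longleftrightarrow> a * u = 0" for u
    by (metis ah(3) pa(2) p_def mult.assoc mult_zero_right)
  have pc: "p * c = 0" using assms(4) by (simp add: p_zero_iff q_eq c_def mult.assoc)
  have qc: "q * c = c" using pc by (simp add: q_def algebra_simps)
  have cp: "c * p = 0" by (simp add: c_def mult.assoc qq)
  \<comment> \<open>\<open>pc\<close> says \<open>p * b * q = 0\<close>, that is,
    \<open>p * b * p = p * b\<close>.\<close>
  have s: "p * s = s" "s * p = s"
    using pa pp pc by (simp_all add: s_def c_def q_def algebra_simps flip: mult.assoc)
  have d: "p * d = 0" "d * p = d" by (simp_all add: d_def mult.assoc pp mult_eq_assoc[OF qq(2)])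
  have qb: "q * b = d + c"
    using qc by (simp add: d_def c_def q_def algebra_simps)
  have s_eq: "a * (1 + h * b) = s" by (simp add: s_def p_def algebra_simps)
  have t_eq: "a + b = s + d + c"
    using qb by (simp add: s_def q_def algebra_simps)
  obtain y where y: "is_core_inverse c y"
    using assms(3) by (auto simp: core_invertible_def q_eq c_def)
  note g = group_inverse_if_core_inverse[OF y]
  obtain z where z: "is_group_inverse b z"
    using group_invertible_if_core_invertible[OF assms(2)] by (auto simp: group_invertible_def)
  have "z * q = y * y * c"
    using group_inverse_mult_corner[OF z] g(1) qc by (simp add: c_def)
  moreover have "q * (y * y * c) = y * y * c"
    using g(1) qc unfolding is_group_inverse_def by (metis mult.assoc)
  \<comment> \<open>\<open>b * z * q = b * q * (y * y * c) = c * (y * y * c) = y * c\<close>.\<close>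
  ultimately have bzq: "b * z * q = y * c" by (metis g(2) c_def mult.assoc)
  have ycb: "y * c * b = y * c * (q * b)" by (metis c_def qq(1) mult.assoc)
  have yc: "y * (c * c) = c" using y by (simp add: is_core_inverse_def power2_eq_square)
  have "spectral_idem b * q * b = q * b - b * z * q * b"
    by (simp add: spectral_idem_def group_inv_eq[OF z] left_diff_distrib)
  also have "\<dots> = d - y * c * d"
    unfolding bzq ycb qb by (simp add: distrib_left yc mult.assoc)
  finally have "spectral_idem b * q * b = d - y * c * d" .
  \<comment> \<open>The idempotents \<open>y * c\<close> and \<open>c * y\<close> both have the
    range of \<open>c\<close>, so they fix the same elements.\<close>
  moreover have "y * c * d = d \<longleftrightarrow> c * y * d = d"
  proof
    assume "y * c * d = d"
    then have "d = c * (y * y * c * d)" by (metis g(2) mult.assoc)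
    then show "c * y * d = d" by (metis core_inverse_inner[OF y] mult.assoc)
  next
    assume "c * y * d = d"
    then show "y * c * d = d" by (metis yc mult.assoc)
  qed
  ultimately have idem_iff: "spectral_idem b * q * b = 0 \<longleftrightarrow> c * y * d = d" by auto
  have core_iff: "a * core_inv (a + b) * q = 0 \<longleftrightarrow> p * core_inv (a + b) * (1 - p) = 0"
    using p_zero_iff[of "core_inv (a + b) * q"] by (simp add: mult.assoc flip: q_def)
  show ?thesis
    unfolding q_eq core_iff idem_iff s_eq[unfolded h_def] unfolding t_eq
    by (rule triangular_core_invertible_iff[OF star_p pp s pc cp d y])
qed

end
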